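(* Let $\alpha$ be a non-empty finite set, $\tau$ an involution on $\alpha$, and let $S=\{(a,a,a)\mid a\in\alpha\}$ be diagonal. Then there exist non-trivial finite type invariants of degree $2$ (for the homotopy given by $(\alpha,\tau,S)$) which are independent of Fukunaga's $T$ invariant; that is, there exist a positive integer $n$, a finite type invariant $v$ of degree $2$ of $n$-component nanophrases over $\alpha$, and $n$-component nanophrases $p,q$ over $\alpha$ with $T(p)=T(q)$ but $v(p)\neq v(q)$.
   Context: Nanophrases and homotopy. An $n$-component Gauss phrase is a sequence of $n$ (possibly empty) finite words, written separated by the symbol $|$, such that every letter occurring in it occurs exactly twice in total. An $n$-component nanophrase over $\alpha$ is an $n$-component Gauss phrase $p$ together with a map $A\mapsto |A|$ from the set of letters appearing in $p$ to $\alpha$. Two nanophrases are isomorphic if a bijection of their letter sets preserving the map to $\alpha$ carries one Gauss phrase to the other letterwise. The homotopy given by $(\alpha,\tau,S)$ is the equivalence relation on $n$-component nanophrases generated by isomorphism and the moves (in both directions) H1: $xAAy\leftrightarrow xy$; H2: $xAByBAz\leftrightarrow xyz$ if $|A|=\tau(|B|)$; H3: $xAByACzBCt\leftrightarrow xBAyCAzCBt$ if $(|A|,|B|,|C|)\in S$; here $x,y,z,t$ are arbitrary sequences of letters, possibly including $|$, such that both sides are nanophrases, and all remaining letters keep their images in $\alpha$. An involution is a map $\tau$ with $\tau\circ\tau=\mathrm{id}$. Finite type invariants. $P(\alpha,\tau,S,n)$ is the set of homotopy classes of $n$-component nanophrases and $\mathbb{Z}P(\alpha,\tau,S,n)$ the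 free abelian group on it. A homotopy invariant is a function on $P(\alpha,\tau,S,n)$ with values in an additive abelian group, extended linearly to $\mathbb{Z}P(\alpha,\tau,S,n)$. A nanophrase in which a letter $A$ is marked as a semi-letter $\dot A$ denotes the formal sum $x\dot Ay\dot Az=xAyAz-xyz$; applied recursively, this defines nanophrases with any number of semi-letters. A homotopy invariant $v$ is a finite type invariant if there is an integer $m$ such that $v(p)=0$ for every nanophrase $p$ with more than $m$ semi-letters; the least such $m\ge 0$ is the degree of $v$. The $T$ invariant. An orientation $\alpha_o$ of $\alpha$ is a subset meeting each $\tau$-orbit in exactly one element; fix one. For an $n$-component nanophrase $p$ let $\mathcal{A}(p)$ be its set of letters. Define $n_p(X,X)=0$ and, for distinct letters $X,Y$, $n_p(X,Y)=1$ if $X$ and $Y$ appear alternating in $p$ (i.e. in the concatenation of its components) starting with $X$, $-1$ if they appear alternating starting with $Y$, and $0$ if they do not appear alternating. For $a\in\alpha$ put $\varepsilon_a(X)=1$ if $|X|=a$, $-1$ if $|X|=\tau(a)\neq a$, and $0$ otherwise. Put $t_p(a,b,X)=\sum_{Y\in\mathcal{A}(p)}\varepsilon_a(X)\varepsilon_b(Y)n_p(X,Y)$. Let $\mathcal{A}_i(p)$ be the set of letters both of whose occurrences are in the $i$th component. Define $T^i_{a,b}(p)=\sum_{A\in\mathcal{A}_i(p)}t_p(a,b,A)$, taken in $\mathbb{Z}$ if $a\neq\tau(a)$ and $b\neq\tau(b)$, and taken modulo $2$ in $\mathbb{Z}/2\mathbb{Z}$ otherwise. $T^i(p)$ is the tuple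 of all $T^i_{a,b}(p)$ with $a,b\in\alpha_o$, and $T(p)=(T^1(p),\dots,T^n(p))$. It is known (Fukunaga) that $T$ is a homotopy invariant when $S$ is diagonal. *)

theory Defs
  imports "HOL-Algebra.Free_Abelian_Groups" "HOL-Algebra.Elementary_Groups"
begin

section \<open>Nanophrases\<close>

text \<open>
  Letters are drawn from the countable supply \<^typ>\<open>nat\<close>; as nanophrases are considered up to
  renaming of letters, this loses no generality. A nanophrase is its list of components together
  with the map from its letters to \<open>\<alpha>\<close>, a partial map defined exactly on the letters that occur.
  The set \<open>\<alpha>\<close> is the type \<^typ>\<open>'a\<close>.
\<close>

type_synonym letter = nat
type_synonym word = "letter list"
type_synonym 'a nanophrase = "word list \<times> (letter \<Rightarrow> 'a option)"

definition gauss_phrase :: "nat \<Rightarrow> word list \<Rightarrow> bool" where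
  "gauss_phrase n ws \<longleftrightarrow>
     length ws = n \<and> (\<forall>A \<in> set (concat ws). count_list (concat ws) A = 2)"

definition letters :: "'a nanophrase \<Rightarrow> letter set" where
  "letters p = set (concat (fst p))"

definition nanophrases :: "nat \<Rightarrow> 'a nanophrase set" where
  "nanophrases n = {p. gauss_phrase n (fst p) \<and> dom (snd p) = letters p}"

definition isomorphic :: "'a nanophrase \<Rightarrow> 'a nanophrase \<Rightarrow> bool" where
  "isomorphic p q \<longleftrightarrow>
     (\<exists>f. bij_betw f (letters p) (letters q) \<and>
          (\<forall>A \<in> letters p. snd q (f A) = snd p A) \<and>
          fst q = map (map f) (fst p))"

section \<open>Homotopy\<close>

datatype symb = Letter letter | Bar

text \<open>The phrase as a single sequence, its components separated by bars. This form is injective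
  among phrases with the same number of components.\<close>

fun written :: "word list \<Rightarrow> symb list" where
  "written [] = []"
| "written [w] = map Letter w"
| "written (w # v # ws) = map Letter w @ Bar # written (v # ws)"

text \<open>The generators in one direction only; \<open>equivclp\<close> below adds the inverses.\<close>

inductive homotopy_step ::
  "nat \<Rightarrow> ('a \<Rightarrow> 'a) \<Rightarrow> ('a \<times> 'a \<times> 'a) set \<Rightarrow> 'a nanophrase \<Rightarrow> 'a nanophrase \<Rightarrow> bool"
  for n \<tau> S where
  iso: "\<lbrakk> p \<in> nanophrases n; q \<in> nanophrases n; isomorphic p q \<rbrakk>
    \<Longrightarrow> homotopy_step n \<tau> S p q"
| H1: "\<lbrakk> p \<in> nanophrases n; q \<in> nanophrases n;
     written (fst p) = x @ [Letter A, Letter A] @ y;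
     written (fst q) = x @ y;
     \<forall>D \<in> letters q. snd q D = snd p D \<rbrakk>
    \<Longrightarrow> homotopy_step n \<tau> S p q"
| H2: "\<lbrakk> p \<in> nanophrases n; q \<in> nanophrases n;
     written (fst p) = x @ [Letter A, Letter B] @ y @ [Letter B, Letter A] @ z;
     written (fst q) = x @ y @ z;
     snd p A = Some a; snd p B = Some b; a = \<tau> b;
     \<forall>D \<in> letters q. snd q D = snd p D \<rbrakk>
    \<Longrightarrow> homotopy_step n \<tau> S p q"
| H3: "\<lbrakk> p \<in> nanophrases n; q \<in> nanophrases n;
     written (fst p) =
       x @ [Letter A, Letter B] @ y @ [Letter A, Letter C] @ z @ [Letter B, Letter C] @ t;
     written (fst q) =
       x @ [Letter B, Letter A] @ y @ [Letter C, Letter A] @ z @ [Letter C, Letter B] @ t;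
     snd p A = Some a; snd p B = Some b; snd p C = Some c; (a, b, c) \<in> S;
     \<forall>D \<in> letters q. snd q D = snd p D \<rbrakk>
    \<Longrightarrow> homotopy_step n \<tau> S p q"

definition homotopy_rel ::
  "nat \<Rightarrow> ('a \<Rightarrow> 'a) \<Rightarrow> ('a \<times> 'a \<times> 'a) set \<Rightarrow> ('a nanophrase \<times> 'a nanophrase) set" where
  "homotopy_rel n \<tau> S =
     {(p, q). p \<in> nanophrases n \<and> q \<in> nanophrases n \<and> equivclp (homotopy_step n \<tau> S) p q}"

definition homotopy_classes ::
  "nat \<Rightarrow> ('a \<Rightarrow> 'a) \<Rightarrow> ('a \<times> 'a \<times> 'a) set \<Rightarrow> 'a nanophrase set set" where
  "homotopy_classes n \<tau> S = nanophrases n // homotopy_rel n \<tau> S"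

definition homotopy_class ::
  "nat \<Rightarrow> ('a \<Rightarrow> 'a) \<Rightarrow> ('a \<times> 'a \<times> 'a) set \<Rightarrow> 'a nanophrase \<Rightarrow> 'a nanophrase set" where
  "homotopy_class n \<tau> S p = homotopy_rel n \<tau> S `` {p}"

section \<open>Finite type invariants\<close>

definition delete_letter :: "letter \<Rightarrow> 'a nanophrase \<Rightarrow> 'a nanophrase" where
  "delete_letter A p = (map (removeAll A) (fst p), (snd p)(A := None))"

text \<open>The element of the free abelian group on the homotopy classes denoted by the nanophrase \<open>p\<close>
  with the letters in the given list marked as semi-letters.\<close>

fun semi :: "nat \<Rightarrow> ('a \<Rightarrow> 'a) \<Rightarrow> ('a \<times> 'a \<times> 'a) set \<Rightarrow> 'a nanophrase \<Rightarrow> letter list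
    \<Rightarrow> 'a nanophrase set \<Rightarrow>\<^sub>0 int" where
  "semi n \<tau> S p [] = frag_of (homotopy_class n \<tau> S p)"
| "semi n \<tau> S p (A # As) = semi n \<tau> S p As - semi n \<tau> S (delete_letter A p) As"

text \<open>Values lie in an abelian group \<open>G\<close>, which the library writes multiplicatively: the zero of
  \<open>G\<close> is \<open>\<one>\<close>, and integer multiples are integer powers. To assert that an invariant with values
  in some abelian group exists it suffices to let \<open>G\<close> range over the groups of type
  \<^typ>\<open>int monoid\<close>: for finite \<open>\<alpha>\<close> there are countably many homotopy classes, so the values of an
  invariant generate a countable group, and every countable group has an isomorphic copy whose
  carrier is a set of integers.\<close>

definition linear_extension :: "'g monoid \<Rightarrow> ('b \<Rightarrow> 'g) \<Rightarrow> ('b \<Rightarrow>\<^sub>0 int) \<Rightarrow> 'g" where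
  "linear_extension G v c =
     (\<Otimes>\<^bsub>G\<^esub>x \<in> Poly_Mapping.keys c. v x [^]\<^bsub>G\<^esub> Poly_Mapping.lookup c x)"

definition homotopy_invariant ::
  "nat \<Rightarrow> ('a \<Rightarrow> 'a) \<Rightarrow> ('a \<times> 'a \<times> 'a) set \<Rightarrow> 'g monoid \<Rightarrow> ('a nanophrase set \<Rightarrow> 'g) \<Rightarrow> bool" where
  "homotopy_invariant n \<tau> S G v \<longleftrightarrow>
     comm_group G \<and> v \<in> homotopy_classes n \<tau> S \<rightarrow> carrier G"

definition vanishes_above ::
  "nat \<Rightarrow> ('a \<Rightarrow> 'a) \<Rightarrow> ('a \<times> 'a \<times> 'a) set \<Rightarrow> 'g monoid \<Rightarrow> ('a nanophrase set \<Rightarrow> 'g) \<Rightarrow> nat \<Rightarrow> bool"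
  where
  "vanishes_above n \<tau> S G v m \<longleftrightarrow>
     (\<forall>p \<in> nanophrases n. \<forall>As. distinct As \<and> set As \<subseteq> letters p \<and> length As > m \<longrightarrow>
        linear_extension G v (semi n \<tau> S p As) = \<one>\<^bsub>G\<^esub>)"

definition finite_type_invariant ::
  "nat \<Rightarrow> ('a \<Rightarrow> 'a) \<Rightarrow> ('a \<times> 'a \<times> 'a) set \<Rightarrow> 'g monoid \<Rightarrow> ('a nanophrase set \<Rightarrow> 'g) \<Rightarrow> bool" where
  "finite_type_invariant n \<tau> S G v \<longleftrightarrow>
     homotopy_invariant n \<tau> S G v \<and> (\<exists>m. vanishes_above n \<tau> S G v m)"

definition invariant_degree ::
  "nat \<Rightarrow> ('a \<Rightarrow> 'a) \<Rightarrow> ('a \<times> 'a \<times> 'a) set \<Rightarrow> 'g monoid \<Rightarrow> ('a nanophrase set \<Rightarrow> 'g) \<Rightarrow> nat" where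
  "invariant_degree n \<tau> S G v = (LEAST m. vanishes_above n \<tau> S G v m)"

section \<open>Fukunaga's invariant\<close>

text \<open>For an involution \<open>\<tau>\<close> the orbit of \<open>a\<close> is \<open>{a, \<tau> a}\<close>.\<close>

definition orientation :: "('a \<Rightarrow> 'a) \<Rightarrow> 'a set \<Rightarrow> bool" where
  "orientation \<tau> \<alpha>\<^sub>o \<longleftrightarrow> (\<forall>a. card (\<alpha>\<^sub>o \<inter> {a, \<tau> a}) = 1)"

definition alternation :: "'a nanophrase \<Rightarrow> letter \<Rightarrow> letter \<Rightarrow> int" where
  "alternation p X Y =
     (let w = filter (\<lambda>Z. Z = X \<or> Z = Y) (concat (fst p)) in
      if X = Y then 0
      else if w = [X, Y, X, Y] then 1
      else if w = [Y, X, Y, X] then -1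
      else 0)"

definition letter_sign :: "('a \<Rightarrow> 'a) \<Rightarrow> 'a nanophrase \<Rightarrow> 'a \<Rightarrow> letter \<Rightarrow> int" where
  "letter_sign \<tau> p a X =
     (if snd p X = Some a then 1
      else if snd p X = Some (\<tau> a) \<and> \<tau> a \<noteq> a then -1
      else 0)"

definition t_coeff :: "('a \<Rightarrow> 'a) \<Rightarrow> 'a nanophrase \<Rightarrow> 'a \<Rightarrow> 'a \<Rightarrow> letter \<Rightarrow> int" where
  "t_coeff \<tau> p a b X =
     (\<Sum>Y \<in> letters p. letter_sign \<tau> p a X * letter_sign \<tau> p b Y * alternation p X Y)"

definition letters_in :: "nat \<Rightarrow> 'a nanophrase \<Rightarrow> letter set" where
  "letters_in i p = {A \<in> letters p. count_list (fst p ! i) A = 2}"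

text \<open>Elements of \<open>\<int>/2\<int>\<close> are represented by \<open>0\<close> and \<open>1\<close>.\<close>

definition T_entry :: "('a \<Rightarrow> 'a) \<Rightarrow> 'a nanophrase \<Rightarrow> nat \<Rightarrow> 'a \<Rightarrow> 'a \<Rightarrow> int" where
  "T_entry \<tau> p i a b =
     (let s = (\<Sum>A \<in> letters_in i p. t_coeff \<tau> p a b A) in
      if a \<noteq> \<tau> a \<and> b \<noteq> \<tau> b then s else s mod 2)"

text \<open>Components are numbered from \<open>0\<close>. Each tuple indexed by \<open>\<alpha>\<^sub>o \<times> \<alpha>\<^sub>o\<close> is an extensional
  function, so that equality of tuples is equality of their entries.\<close>

definition T_invariant ::
  "('a \<Rightarrow> 'a) \<Rightarrow> 'a set \<Rightarrow> 'a nanophrase \<Rightarrow> ('a \<times> 'a \<Rightarrow> int) list" where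
  "T_invariant \<tau> \<alpha>\<^sub>o p =
     map (\<lambda>i. \<lambda>(a, b) \<in> \<alpha>\<^sub>o \<times> \<alpha>\<^sub>o. T_entry \<tau> p i a b) [0..<length (fst p)]"

end

theory Submission
  imports Defs
begin

text \<open>
  The invariant is a product of two linking numbers modulo 2. For two different components \<open>i\<close>
  and \<open>j\<close>, the parity of the number of letters that occur once in each is a homotopy invariant: H1
  concerns a letter inside one component, H2 adds or removes two letters that lie in the same pair
  of components, and H3 leaves every letter in its components. Take \<open>n = 3\<close> and multiply the
  parity for components 0 and 1 with the parity for components 0 and 2.

  Each of the two numbers is a sum of contributions of single letters, so marking one letter
  leaves only the contribution of that letter, and marking a second letter gives zero. A product of two such numbers
  behaves like a quadratic polynomial: all its third differences vanish
  (\<open>finite_difference_linking_product\<close>). On the phrase \<open>AB|A|B\<close> with both letters marked the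
  value is 1, so the degree is 2.

  The invariant \<open>T\<close> only sums over letters with both occurrences in one component. The phrase
  \<open>AB|A|B\<close> has none, so \<open>T\<close> cannot tell it from the empty phrase, whereas the product of the
  linking numbers is 1 on the former and 0 on the latter.
\<close>

section \<open>Linking numbers and homotopy\<close>

definition linking_number :: "nat \<Rightarrow> nat \<Rightarrow> 'a nanophrase \<Rightarrow> int" where
  "linking_number i j p = int (card (set (fst p ! i) \<inter> set (fst p ! j)))"

text \<open>The moves are phrased on the sequence with bars; this recovers the letters of the \<open>i\<close>th
  component from it in a way that is compatible with concatenation.\<close>

fun letters_at :: "symb list \<Rightarrow> nat \<Rightarrow> letter set" where
  "letters_at [] i = {}"
| "letters_at (Letter A # s) i = (if i = 0 then {A} else {}) \<union> letters_at s i"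
| "letters_at (Bar # s) 0 = {}"
| "letters_at (Bar # s) (Suc i) = letters_at s i"

lemma letters_at_append:
  "letters_at (s @ t) i =
     letters_at s i \<union> (if count_list s Bar \<le> i then letters_at t (i - count_list s Bar) else {})"
  by (induction s i rule: letters_at.induct) auto

lemma letters_at_map_Letter: "letters_at (map Letter w) i = (if i = 0 then set w else {})"
  by (induction w) auto

lemma count_Bar_map_Letter: "count_list (map Letter w) Bar = 0"
  by (induction w) auto

lemma letters_at_written:
  "i < length ws \<Longrightarrow> letters_at (written ws) i = set (ws ! i)"
proof (induction ws arbitrary: i rule: written.induct)
  case (3 w v ws)
  then show ?case
    by (cases i) (auto simp: letters_at_append letters_at_map_Letter count_Bar_map_Letter)
qed (auto simp: letters_at_map_Letter)

lemma letters_at_subset: "letters_at s i \<subseteq> {A. Letter A \<in> set s}"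
  by (induction s i rule: letters_at.induct) (auto split: if_splits)

lemma count_map_Letter: "count_list (map Letter w) (Letter A) = count_list w A"
  by (induction w) auto

lemma count_written: "count_list (written ws) (Letter A) = count_list (concat ws) A"
  by (induction ws rule: written.induct) (auto simp: count_map_Letter)

lemma count_written_nanophrase:
  assumes "p \<in> nanophrases n" and "Letter A \<in> set (written (fst p))"
  shows "count_list (written (fst p)) (Letter A) = 2"
proof -
  have "count_list (concat (fst p)) A \<noteq> 0"
    using assms(2) by (metis count_list_0_iff count_written)
  then show ?thesis
    using assms(1) by (auto simp: nanophrases_def gauss_phrase_def count_written count_list_0_iff)
qed

lemma linking_number_written:
  assumes "p \<in> nanophrases n" and "i < n" and "j < n"
  shows "linking_number i j p =
           int (card (letters_at (written (fst p)) i \<inter> letters_at (written (fst p)) j))"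
  using assms
  by (simp add: linking_number_def letters_at_written nanophrases_def gauss_phrase_def)

lemma linking_number_isomorphic:
  assumes "p \<in> nanophrases n" and "isomorphic p q" and "i < n" and "j < n"
  shows "linking_number i j q = linking_number i j p"
proof -
  obtain f where f: "bij_betw f (letters p) (letters q)" "fst q = map (map f) (fst p)"
    using assms(2) by (auto simp: isomorphic_def)
  have len: "i < length (fst p)" "j < length (fst p)"
    using assms by (auto simp: nanophrases_def gauss_phrase_def)
  then have sub: "set (fst p ! i) \<subseteq> letters p" "set (fst p ! j) \<subseteq> letters p"
    by (auto simp: letters_def intro: nth_mem)
  have inj: "inj_on f (letters p)" using f(1) by (rule bij_betw_imp_inj_on)
  have "set (fst q ! i) \<inter> set (fst q ! j) = f ` (set (fst p ! i) \<inter> set (fst p ! j))"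
    using len f(2) inj_on_image_Int[OF inj sub] by simp
  moreover have "inj_on f (set (fst p ! i) \<inter> set (fst p ! j))"
    using inj sub by (meson inf.coboundedI1 inj_on_subset)
  ultimately show ?thesis by (simp add: linking_number_def card_image)
qed

lemma linking_number_H1:
  assumes "p \<in> nanophrases n" "q \<in> nanophrases n" "i < n" "j < n" "i \<noteq> j"
    and w: "written (fst p) = x @ [Letter A, Letter A] @ y" "written (fst q) = x @ y"
  shows "linking_number i j p = linking_number i j q"
proof -
  have "count_list (written (fst p)) (Letter A) = 2"
    by (rule count_written_nanophrase[OF assms(1)]) (simp add: w)
  then have "Letter A \<notin> set x" "Letter A \<notin> set y"
    by (auto simp: w(1) count_list_0_iff)
  then have "A \<notin> letters_at x k" "A \<notin> letters_at y k" for k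
    using letters_at_subset by blast+
  then have "letters_at (written (fst p)) i \<inter> letters_at (written (fst p)) j =
      letters_at (written (fst q)) i \<inter> letters_at (written (fst q)) j"
    unfolding w using \<open>i \<noteq> j\<close> by (auto simp: letters_at_append split: if_splits)
  then show ?thesis using assms by (simp add: linking_number_written)
qed

lemma linking_number_H2:
  assumes "p \<in> nanophrases n" "q \<in> nanophrases n" "i < n" "j < n" "i \<noteq> j"
    and w: "written (fst p) = x @ [Letter A, Letter B] @ y @ [Letter B, Letter A] @ z"
      "written (fst q) = x @ y @ z"
  shows "linking_number i j p mod 2 = linking_number i j q mod 2"
proof -
  let ?P = "letters_at (written (fst p)) i \<inter> letters_at (written (fst p)) j"
  let ?Q = "letters_at (written (fst q)) i \<inter> letters_at (written (fst q)) j"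
  let ?k = "count_list x Bar" and ?m = "count_list x Bar + count_list y Bar"
  have cA: "count_list (written (fst p)) (Letter A) = 2"
    and cB: "count_list (written (fst p)) (Letter B) = 2"
    by (rule count_written_nanophrase[OF assms(1)]; simp add: w)+
  have "A \<noteq> B" using cA by (auto simp: w(1))
  have "Letter A \<notin> set x" "Letter A \<notin> set y" "Letter A \<notin> set z"
    "Letter B \<notin> set x" "Letter B \<notin> set y" "Letter B \<notin> set z"
    using cA cB \<open>A \<noteq> B\<close> by (auto simp: w(1) count_list_0_iff)
  then have notin: "A \<notin> letters_at x k" "A \<notin> letters_at y k" "A \<notin> letters_at z k"
    "B \<notin> letters_at x k" "B \<notin> letters_at y k" "B \<notin> letters_at z k" for k
    using letters_at_subset by blast+
  have at: "letters_at (written (fst p)) k =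
      letters_at (written (fst q)) k \<union> (if k = ?k \<or> k = ?m then {A, B} else {})" for k
    unfolding w by (auto simp: letters_at_append split: if_splits)
  have new: "A \<notin> letters_at (written (fst q)) k" "B \<notin> letters_at (written (fst q)) k" for k
    unfolding w using notin by (auto simp: letters_at_append)
  have fin: "finite ?Q"
    using assms(2-4)
    by (simp add: letters_at_written nanophrases_def gauss_phrase_def)
  \<comment> \<open>The two letters share their pair of components, so that pair gains both or neither.\<close>
  have "?P = ?Q \<union> (if {i, j} = {?k, ?m} then {A, B} else {})"
    using new \<open>i \<noteq> j\<close> unfolding at by (auto simp: doubleton_eq_iff)
  moreover have "card (?Q \<union> {A, B}) = card ?Q + 2"
    using fin new \<open>A \<noteq> B\<close> by simp
  ultimately have "card ?P = card ?Q \<or> card ?P = card ?Q + 2"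
    by (auto split: if_splits)
  then have "int (card ?P) mod 2 = int (card ?Q) mod 2" by auto
  then show ?thesis using assms by (simp add: linking_number_written)
qed

lemma linking_number_H3:
  assumes "p \<in> nanophrases n" "q \<in> nanophrases n" "i < n" "j < n"
    and w: "written (fst p) =
       x @ [Letter A, Letter B] @ y @ [Letter A, Letter C] @ z @ [Letter B, Letter C] @ t"
      "written (fst q) =
       x @ [Letter B, Letter A] @ y @ [Letter C, Letter A] @ z @ [Letter C, Letter B] @ t"
  shows "linking_number i j p = linking_number i j q"
proof -
  have "letters_at (written (fst p)) k = letters_at (written (fst q)) k" for k
    unfolding w by (auto simp: letters_at_append)
  then show ?thesis using assms by (simp add: linking_number_written)
qed

lemma linking_number_step:
  assumes "homotopy_step n \<tau> S p q" and "i < n" "j < n" "i \<noteq> j"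
  shows "linking_number i j p mod 2 = linking_number i j q mod 2"
  using assms(1)
proof cases
  case iso
  then show ?thesis using linking_number_isomorphic assms by metis
next
  case (H1 x A y)
  then show ?thesis using linking_number_H1 assms by metis
next
  case (H2 x A B y z a b)
  then show ?thesis using linking_number_H2 assms by metis
next
  case (H3 x A B y C z t a b c)
  then show ?thesis using linking_number_H3 assms by metis
qed

lemma linking_number_homotopic:
  assumes "equivclp (homotopy_step n \<tau> S) p q" and "i < n" "j < n" "i \<noteq> j"
  shows "linking_number i j p mod 2 = linking_number i j q mod 2"
  using assms(1)
proof (induction rule: equivclp_induct)
  case base
  show ?case by simp
next
  case (step q r)
  then show ?case using linking_number_step assms by metis
qed

section \<open>The product of two linking numbers\<close>

definition linking_product :: "'a nanophrase \<Rightarrow> int" where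
  "linking_product p = linking_number 0 1 p * linking_number 0 2 p"

text \<open>The choice of the representative does not matter by \<open>linking_product_class_eq\<close>.\<close>

definition linking_product_class :: "'a nanophrase set \<Rightarrow> int" where
  "linking_product_class c = linking_product (SOME p. p \<in> c) mod 2"

lemma linking_product_class_eq:
  assumes "p \<in> nanophrases 3"
  shows "linking_product_class (homotopy_class 3 \<tau> S p) = linking_product p mod 2"
proof -
  define q where "q = (SOME q. q \<in> homotopy_class 3 \<tau> S p)"
  have "p \<in> homotopy_class 3 \<tau> S p"
    using assms by (simp add: homotopy_class_def homotopy_rel_def)
  then have "q \<in> homotopy_class 3 \<tau> S p"
    unfolding q_def by (rule someI)
  then have h: "equivclp (homotopy_step 3 \<tau> S) p q"
    by (simp add: homotopy_class_def homotopy_rel_def)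
  have "linking_product p mod 2 = linking_product q mod 2"
    unfolding linking_product_def
    by (intro mod_mult_cong linking_number_homotopic[OF h]) auto
  then show ?thesis by (simp add: linking_product_class_def q_def)
qed

section \<open>Linear extension and finite differences\<close>

definition pairing :: "('b \<Rightarrow> int) \<Rightarrow> ('b \<Rightarrow>\<^sub>0 int) \<Rightarrow> int" where
  "pairing v c = (\<Sum>x \<in> Poly_Mapping.keys c. Poly_Mapping.lookup c x * v x)"

lemma pairing_of: "pairing v (frag_of x) = v x"
  by (simp add: pairing_def)

lemma pairing_diff: "pairing v (c - d) = pairing v c - pairing v d"
proof -
  let ?K = "Poly_Mapping.keys c \<union> Poly_Mapping.keys d"
  have *: "pairing v e = (\<Sum>x \<in> ?K. Poly_Mapping.lookup e x * v x)"
    if "Poly_Mapping.keys e \<subseteq> ?K" for e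
    unfolding pairing_def using that
    by (intro sum.mono_neutral_left) (auto simp: in_keys_iff)
  have "Poly_Mapping.keys (c - d) \<subseteq> ?K" by (rule keys_diff)
  then show ?thesis
    by (simp add: * lookup_minus sum_subtractf left_diff_distrib)
qed

text \<open>Reducing modulo \<open>n\<close> only at the end allows the rest of the argument to run over the
  integers, where third differences vanish exactly.\<close>

lemma linear_extension_mod:
  assumes "n > 0"
  shows "linear_extension (integer_mod_group n) (\<lambda>x. v x mod int n) c = pairing v c mod int n"
proof -
  interpret comm_group "integer_mod_group n" by (rule abelian_integer_mod_group)
  have carr: "v x mod int n \<in> carrier (integer_mod_group n)" for x
    using assms by (simp add: carrier_integer_mod_group)
  have "(\<Otimes>\<^bsub>integer_mod_group n\<^esub>x \<in> K. (v x mod int n) [^]\<^bsub>integer_mod_group n\<^esub> f x) =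
      (\<Sum>x \<in> K. f x * v x) mod int n" if "finite K" for K and f :: "_ \<Rightarrow> int"
    using that
  proof (induction K)
    case empty
    show ?case by simp
  next
    case (insert x K)
    have closed: "(v x mod int n) [^]\<^bsub>integer_mod_group n\<^esub> f x \<in> carrier (integer_mod_group n)"
      for x
      using carr by (rule int_pow_closed)
    show ?case
      using insert closed by (subst finprod_insert) (auto simp: int_pow_integer_mod_group mod_simps)
  qed
  then show ?thesis by (simp add: linear_extension_def pairing_def)
qed

text \<open>This is the alternating sum over deletions of subsets of the marked letters, as in \<open>semi\<close>,
  but for an arbitrary function instead of the universal one.\<close>

fun finite_difference :: "('a nanophrase \<Rightarrow> int) \<Rightarrow> 'a nanophrase \<Rightarrow> letter list \<Rightarrow> int" where
  "finite_difference h p [] = h p"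
| "finite_difference h p (A # As) =
     finite_difference h p As - finite_difference h (delete_letter A p) As"

lemma letters_delete: "letters (delete_letter A p) = letters p - {A}"
  by (auto simp: letters_def delete_letter_def)

lemma delete_letter_nanophrase:
  assumes "p \<in> nanophrases n"
  shows "delete_letter A p \<in> nanophrases n"
proof -
  have conc: "concat (map (removeAll A) ws) = removeAll A (concat ws)" for ws :: "word list"
    by (induction ws) auto
  have cnt: "count_list (removeAll A w) B = (if B = A then 0 else count_list w B)" for w B
    by (induction w) auto
  have "dom (snd (delete_letter A p)) = letters (delete_letter A p)"
    using assms unfolding letters_delete by (auto simp: nanophrases_def delete_letter_def)
  then show ?thesis
    using assms
    by (simp add: nanophrases_def gauss_phrase_def delete_letter_def conc cnt)
qed

lemma pairing_semi:
  assumes "p \<in> nanophrases n"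
    and "\<And>q. q \<in> nanophrases n \<Longrightarrow> v (homotopy_class n \<tau> S q) mod k = h q mod k"
  shows "pairing v (semi n \<tau> S p As) mod k = finite_difference h p As mod k"
  using assms(1)
proof (induction As arbitrary: p)
  case Nil
  then show ?case by (simp add: pairing_of assms(2))
next
  case (Cons A As)
  then show ?case
    unfolding semi.simps finite_difference.simps pairing_diff
    by (intro mod_diff_cong) (auto simp: delete_letter_nanophrase)
qed

text \<open>Both linking numbers are sums over letters: deleting \<open>A\<close> changes them by an amount that
  depends only on the place of \<open>A\<close>.\<close>

lemma linking_number_delete:
  assumes "i < length (fst p)" "j < length (fst p)"
  shows "linking_number i j (delete_letter A p) =
           linking_number i j p - of_bool (A \<in> set (fst p ! i) \<inter> set (fst p ! j))"
proof -
  have "set (fst (delete_letter A p) ! i) \<inter> set (fst (delete_letter A p) ! j) =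
      (set (fst p ! i) \<inter> set (fst p ! j)) - {A}"
    using assms by (auto simp: delete_letter_def)
  moreover have "card (set (fst p ! i) \<inter> set (fst p ! j)) > 0"
    if "A \<in> set (fst p ! i) \<inter> set (fst p ! j)"
    using that by (subst card_gt_0_iff) blast
  ultimately show ?thesis
    by (auto simp: linking_number_def card_Diff_singleton_if of_nat_diff Suc_leI)
qed

lemma in_set_delete_letter:
  "i < length (fst p) \<Longrightarrow> B \<noteq> A \<Longrightarrow>
     B \<in> set (fst (delete_letter A p) ! i) \<longleftrightarrow> B \<in> set (fst p ! i)"
  by (simp add: delete_letter_def)

lemma length_delete_letter: "length (fst (delete_letter A p)) = length (fst p)"
  by (simp add: delete_letter_def)

text \<open>With \<open>x\<close> and \<open>y\<close> the linking numbers and \<open>f\<close>, \<open>g\<close> the contributions of single letters, the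
  second difference is \<open>f A * g B + f B * g A\<close>: it no longer depends on the other letters, so the
  third difference is zero.\<close>

lemma finite_difference_linking_product:
  assumes "length (fst p) = 3" and "distinct As" and "length As > 2"
  shows "finite_difference linking_product p As = 0"
  using assms
proof (induction As arbitrary: p)
  case Nil
  then show ?case by simp
next
  case (Cons A As)
  show ?case
  proof (cases "length As > 2")
    case True
    then show ?thesis using Cons by (simp add: length_delete_letter)
  next
    case False
    then obtain B C where "As = [B, C]"
      using Cons.prems(3) by (cases As; cases "tl As") auto
    then show ?thesis
      using Cons.prems(1,2)
      by (simp add: linking_product_def linking_number_delete in_set_delete_letter
          length_delete_letter algebra_simps)
  qed
qed

section \<open>Degree and independence of the invariant of Fukunaga\<close>

lemma linear_extension_linking_product:
  assumes "p \<in> nanophrases 3"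
  shows "linear_extension (integer_mod_group 2) linking_product_class (semi 3 \<tau> S p As) =
           finite_difference linking_product p As mod 2"
proof -
  have "linear_extension (integer_mod_group 2) linking_product_class (semi 3 \<tau> S p As) =
      pairing linking_product_class (semi 3 \<tau> S p As) mod 2"
    using linear_extension_mod[of 2 linking_product_class "semi 3 \<tau> S p As"]
    by (simp add: linking_product_class_def[abs_def])
  also have "\<dots> = finite_difference linking_product p As mod 2"
    by (rule pairing_semi[OF assms]) (simp add: linking_product_class_eq)
  finally show ?thesis .
qed

lemma vanishes_above_linking_product:
  "vanishes_above 3 \<tau> S (integer_mod_group 2) linking_product_class 2"
  unfolding vanishes_above_def
proof (intro ballI allI impI)
  fix p :: "'a nanophrase" and As
  assume p: "p \<in> nanophrases 3" and As: "distinct As \<and> set As \<subseteq> letters p \<and> length As > 2"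
  have "finite_difference linking_product p As = 0"
    using p As
    by (intro finite_difference_linking_product) (auto simp: nanophrases_def gauss_phrase_def)
  then show "linear_extension (integer_mod_group 2) linking_product_class (semi 3 \<tau> S p As) =
      \<one>\<^bsub>integer_mod_group 2\<^esub>"
    using p by (simp add: linear_extension_linking_product)
qed

text \<open>The smallest phrase with nonzero product: one letter for each factor. It witnesses both that
  the degree is at least 2 and that \<open>T\<close> does not determine the invariant.\<close>

definition chain :: "'a \<Rightarrow> 'a nanophrase" where
  "chain a = ([[0, 1], [0], [1]], [0 \<mapsto> a, 1 \<mapsto> a])"

lemma chain_nanophrase: "chain a \<in> nanophrases 3"
  by (auto simp: chain_def nanophrases_def gauss_phrase_def letters_def)

lemma linking_product_chain: "linking_product (chain a) = 1"
  by (simp add: linking_product_def linking_number_def chain_def)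

lemma not_vanishes_above_linking_product:
  assumes "m < 2"
  shows "\<not> vanishes_above 3 \<tau> S (integer_mod_group 2)
           (linking_product_class :: 'a nanophrase set \<Rightarrow> int) m"
proof
  assume *: "vanishes_above 3 \<tau> S (integer_mod_group 2)
    (linking_product_class :: 'a nanophrase set \<Rightarrow> int) m"
  have "distinct [0, 1 :: letter] \<and> set [0, 1] \<subseteq> letters (chain (undefined :: 'a)) \<and>
      length [0, 1 :: letter] > m"
    using assms by (simp add: chain_def letters_def)
  then have "linear_extension (integer_mod_group 2) linking_product_class
      (semi 3 \<tau> S (chain (undefined :: 'a)) [0, 1]) = \<one>\<^bsub>integer_mod_group 2\<^esub>"
    by (rule *[unfolded vanishes_above_def, rule_format, OF chain_nanophrase])
  then have "finite_difference linking_product (chain (undefined :: 'a)) [0, 1] mod 2 = 0"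
    by (simp add: linear_extension_linking_product chain_nanophrase
        del: semi.simps finite_difference.simps)
  \<comment> \<open>Deleting either letter makes one of the factors zero.\<close>
  then show False
    by (simp add: linking_product_def linking_number_def chain_def delete_letter_def)
qed

lemma degree_linking_product:
  "invariant_degree 3 \<tau> S (integer_mod_group 2) linking_product_class = 2"
  unfolding invariant_degree_def
proof (rule Least_equality)
  fix m
  assume "vanishes_above 3 \<tau> S (integer_mod_group 2) linking_product_class m"
  then show "2 \<le> m" using not_vanishes_above_linking_product not_less by blast
qed (rule vanishes_above_linking_product)

lemma finite_type_linking_product:
  "finite_type_invariant 3 \<tau> S (integer_mod_group 2) linking_product_class"
proof -
  have "linking_product_class c \<in> carrier (integer_mod_group 2)" for c :: "'a nanophrase set"
    by (simp add: linking_product_class_def carrier_integer_mod_group)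
  then show ?thesis
    unfolding finite_type_invariant_def homotopy_invariant_def
    by (intro conjI exI[of _ 2] vanishes_above_linking_product abelian_integer_mod_group) simp
qed

theorem theorem7p3:
  fixes \<tau> :: "'a::finite \<Rightarrow> 'a" and S :: "('a \<times> 'a \<times> 'a) set" and \<alpha>\<^sub>o :: "'a set"
  assumes "\<tau> \<circ> \<tau> = id"
    and "S = {(a, a, a) | a. a \<in> UNIV}"
    and "orientation \<tau> \<alpha>\<^sub>o"
  shows "\<exists>n > 0. \<exists>(G :: int monoid) (v :: 'a nanophrase set \<Rightarrow> int).
           finite_type_invariant n \<tau> S G v \<and> invariant_degree n \<tau> S G v = 2 \<and>
           (\<exists>p \<in> nanophrases n. \<exists>q \<in> nanophrases n.
              T_invariant \<tau> \<alpha>\<^sub>o p = T_invariant \<tau> \<alpha>\<^sub>o q \<and>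
              v (homotopy_class n \<tau> S p) \<noteq> v (homotopy_class n \<tau> S q))"
proof -
  let ?p = "chain (undefined :: 'a)"
  let ?q = "([[], [], []], Map.empty) :: 'a nanophrase"
  have q: "?q \<in> nanophrases 3"
    by (simp add: nanophrases_def gauss_phrase_def letters_def)
  \<comment> \<open>No letter occurs twice in one component, so all sums in \<open>T\<close> are empty.\<close>
  have "letters_in i ?p = {}" "letters_in i ?q = {}" if "i < 3" for i
    using that
    by (auto simp: letters_in_def letters_def chain_def less_Suc_eq numeral_3_eq_3
        split: if_splits)
  then have "T_entry \<tau> ?p i a b = T_entry \<tau> ?q i a b" if "i < 3" for i a b
    using that by (simp add: T_entry_def)
  then have "T_invariant \<tau> \<alpha>\<^sub>o ?p = T_invariant \<tau> \<alpha>\<^sub>o ?q"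
    unfolding T_invariant_def by (intro map_cong) (auto simp: chain_def)
  moreover have "linking_product_class (homotopy_class 3 \<tau> S ?p) \<noteq>
      linking_product_class (homotopy_class 3 \<tau> S ?q)"
    unfolding linking_product_class_eq[OF chain_nanophrase] linking_product_class_eq[OF q]
      linking_product_chain
    by (simp add: linking_product_def linking_number_def)
  ultimately show ?thesis
    by (intro exI[of _ 3] exI[of _ "integer_mod_group 2"] exI[of _ linking_product_class]
        conjI finite_type_linking_product degree_linking_product
        bexI[OF _ chain_nanophrase] bexI[OF _ q]) simp_all
qed

end
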